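(* Let $n\ge1$, let $U$ be an open subset of $\mathbb{R}^{n+1}$, $p_0\in U$, and let $F:U\to\mathbb{R}^{n+1}$ be continuous. Assume there exist an open interval $J$ with $0\in J$ and a simple path $\gamma=(\gamma_1,\gamma_2)\in\mathcal{C}^1(J,U\times\mathbb{P}^n)$ such that: (i) $\gamma_1(0)=p_0$; (ii) there exist $\delta,M\in\mathbb{R}^+$ such that $\omega_F(\gamma_1(t),\gamma_2(t),\delta)<M$ for all $t\in J$; (iii) $\gamma_1'(0)\not\perp\gamma_2(0)$. Then there exist an open neighborhood $\hat U\subset U$ of $p_0$ and a local $n$-foliation of $\hat U$ at $p_0$, with associated diffeomorphism $\Phi:\hat J\times\hat V\to\hat U$ (where $\hat J\subset\mathbb{R}$ is an open interval containing $0$ and $\hat V\subset\mathbb{R}^n$ is open with $0\in\hat V$), such that $F\circ\Phi$ and $(\Phi')^{-1}$ are Lipschitz in a neighborhood of zero when fixing the first variable.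
   Context: $\mathbb{P}^n$ is the real projective space of lines through the origin in $\mathbb{R}^{n+1}$ (with its usual smooth structure); for $w\in\mathbb{R}^{n+1}$ and $v\in\mathbb{P}^n$, $w\perp v$ means that $w$ is orthogonal to the line $v$ with respect to the Euclidean scalar product. A simple path is an injective one. $\|\cdot\|$ is the Euclidean norm. Modulus of continuity: let $B_{n+1}(p,\delta)\subset\mathbb{R}^{n+1}$ be the open ball of center $p$ and radius $\delta$. For $F:U\to\mathbb{R}^{n+1}$, $p\in U$, $v\in\mathbb{P}^n$, $\delta>0$, $$\omega_F(p,v,\delta):=\sup\left\{\frac{\|F(x)-F(y)\|}{\|x-y\|}\ :\ x,y\in B_{n+1}(p,\delta),\ x-p\perp v,\ y-p\perp v,\ x\neq y\right\}\in[0,+\infty]$$ (with $x,y$ in the domain $U$ of $F$). Local $n$-foliation: let $p_0\in\mathbb{R}^{n+1}$. Suppose there are open sets $V\subset\mathbb{R}^n$, $U\subset\mathbb{R}^{n+1}$, an open interval $J\subset\mathbb{R}$ with $0\in J$, and a family of differentiable functions $\{g_s:V\to U\}_{s\in J}$ such that $g_0(0)=p_0\in U$ and $\Phi:J\times V\to U$, $\Phi(s,y)=g_s(y)$, is a diffeomorphism ($C^1$ bijection with $C^1$ inverse). Then $\{g_s\}_{s\in J}$ is called a local $n$-foliation of $U$ at $p_0$, with associated diffeomorphism $\Phi$. $\Phi'$ denotes the derivative (Jacobian matrix) of $\Phi$, and $(\Phi')^{-1}$ the function $x\mapsto(\Phi'(x))^{-1}$ (matrix inverse). Lipschitz when fixing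 the first variable: if $g:D\subset\mathbb{R}^{n+1}\to E$ with $E$ a normed space, $g$ is Lipschitz in $D$ when fixing the first variable if there exists $L>0$ such that for all $(s,x_1,\dots,x_n),(s,y_1,\dots,y_n)\in D$, $$\|g(s,x_1,\dots,x_n)-g(s,y_1,\dots,y_n)\|_E\le L\,\|(x_1,\dots,x_n)-(y_1,\dots,y_n)\|.$$ Matrices carry the usual matrix norm. *)

theory Defs
  imports "HOL-Analysis.Analysis"
begin

text \<open>
  Throughout, \<open>\<real>\<^sup>n\<close> is \<open>real^'n\<close> (so \<open>n = CARD('n) \<ge> 1\<close>) and \<open>\<real>\<^sup>n\<^sup>+\<^sup>1\<close> is
  \<open>real \<times> (real^'n)\<close>, whose library norm and inner product are the Euclidean ones; the
  first component is the first variable.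
\<close>

text \<open>Real projective space: the set of lines through the origin.\<close>

definition proj_space :: "'a::euclidean_space set set" where
  "proj_space = {l. subspace l \<and> dim l = 1}"

definition perp :: "'a::real_inner \<Rightarrow> 'a set \<Rightarrow> bool" where
  "perp w l \<longleftrightarrow> (\<forall>u\<in>l. orthogonal w u)"

text \<open>
  The smooth structure of projective space is given by the standard affine charts, one for
  each basis vector \<open>b\<close>. A line not contained in the hyperplane \<open>v \<bullet> b = 0\<close> is sent to its
  unique point with \<open>b\<close>-coordinate 1. The value of the chart thus lies in the
  \<open>n\<close>-dimensional affine hyperplane \<open>v \<bullet> b = 1\<close>; its remaining coordinates are the
  usual inhomogeneous coordinates, and the constant coordinate is not dropped.
\<close>

definition proj_chart_dom :: "'a::euclidean_space \<Rightarrow> 'a set set" where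
  "proj_chart_dom b = {l \<in> proj_space. \<exists>v\<in>l. v \<bullet> b \<noteq> 0}"

definition proj_chart :: "'a::euclidean_space \<Rightarrow> 'a set \<Rightarrow> 'a" where
  "proj_chart b l = (THE v. v \<in> l \<and> v \<bullet> b = 1)"

definition C1_proj_path_on :: "real set \<Rightarrow> (real \<Rightarrow> 'a::euclidean_space set) \<Rightarrow> bool" where
  "C1_proj_path_on J c \<longleftrightarrow>
     c ` J \<subseteq> proj_space \<and>
     (\<forall>t\<in>J. \<exists>b\<in>Basis. \<exists>T. open T \<and> t \<in> T \<and> T \<subseteq> J \<and>
        c ` T \<subseteq> proj_chart_dom b \<and> (proj_chart b \<circ> c) C1_differentiable_on T)"

text \<open>In \<open>ennreal\<close> the supremum of the empty set is 0.\<close>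

definition modulus_cont ::
  "'a::euclidean_space set \<Rightarrow> ('a \<Rightarrow> 'b::real_normed_vector) \<Rightarrow> 'a \<Rightarrow> 'a set \<Rightarrow> real \<Rightarrow> ennreal"
  where
  "modulus_cont U F p v \<delta> =
     Sup {ennreal (norm (F x - F y) / norm (x - y)) | x y.
            x \<in> U \<inter> ball p \<delta> \<and> y \<in> U \<inter> ball p \<delta> \<and> perp (x - p) v \<and> perp (y - p) v \<and> x \<noteq> y}"

text \<open>Continuous differentiability on an open set.\<close>

definition C1_on ::
  "('a::real_normed_vector \<Rightarrow> 'b::real_normed_vector) \<Rightarrow> 'a set \<Rightarrow> bool" where
  "C1_on f S \<longleftrightarrow>
     (\<exists>f' :: 'a \<Rightarrow> 'a \<Rightarrow>\<^sub>L 'b.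
        (\<forall>x\<in>S. (f has_derivative blinfun_apply (f' x)) (at x)) \<and> continuous_on S f')"

definition C1_diffeo ::
  "('a::real_normed_vector \<Rightarrow> 'b::real_normed_vector) \<Rightarrow> 'a set \<Rightarrow> 'b set \<Rightarrow> bool" where
  "C1_diffeo f A B \<longleftrightarrow>
     open A \<and> open B \<and> bij_betw f A B \<and> C1_on f A \<and> C1_on (inv_into A f) B"

definition foliation_map ::
  "(real \<Rightarrow> (real^'n) \<Rightarrow> real \<times> (real^'n)) \<Rightarrow> real \<times> (real^'n) \<Rightarrow> real \<times> (real^'n)" where
  "foliation_map g = (\<lambda>(s, y). g s y)"

definition local_foliation ::
  "(real \<Rightarrow> (real^'n) \<Rightarrow> real \<times> (real^'n)) \<Rightarrow> real set \<Rightarrow> (real^'n) set \<Rightarrow>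
     (real \<times> (real^'n)) set \<Rightarrow> real \<times> (real^'n) \<Rightarrow> bool" where
  "local_foliation g J V U p\<^sub>0 \<longleftrightarrow>
     open V \<and> open U \<and> open J \<and> is_interval J \<and> 0 \<in> J \<and> 0 \<in> V \<and>
     (\<forall>s\<in>J. g s ` V \<subseteq> U \<and> g s differentiable_on V) \<and>
     g 0 0 = p\<^sub>0 \<and> p\<^sub>0 \<in> U \<and>
     C1_diffeo (foliation_map g) (J \<times> V) U"

text \<open>
  Jacobian matrices are represented by bounded linear maps, with the operator norm. Both
  definitions below are meaningful only at points where the derivative exists and is
  bijective, as is the case for a diffeomorphism on an open set.
\<close>

definition total_deriv ::
  "('a::euclidean_space \<Rightarrow> 'b::euclidean_space) \<Rightarrow> 'a \<Rightarrow> 'a \<Rightarrow>\<^sub>L 'b" where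
  "total_deriv f x = Blinfun (frechet_derivative f (at x))"

definition blinfun_inv ::
  "('a::euclidean_space \<Rightarrow>\<^sub>L 'b::euclidean_space) \<Rightarrow> 'b \<Rightarrow>\<^sub>L 'a" where
  "blinfun_inv A = Blinfun (inv (blinfun_apply A))"

definition lipschitz_fixing_first ::
  "(real \<times> (real^'n)) set \<Rightarrow> (real \<times> (real^'n) \<Rightarrow> 'e::real_normed_vector) \<Rightarrow> bool" where
  "lipschitz_fixing_first D g \<longleftrightarrow>
     (\<exists>L>0. \<forall>s x y. (s, x) \<in> D \<longrightarrow> (s, y) \<in> D \<longrightarrow>
        norm (g (s, x) - g (s, y)) \<le> L * norm (x - y))"

end

theory Submission
  imports Defs
begin

text \<open>
  Near \<open>0\<close> the direction of the line \<open>\<gamma>\<^sub>2 t\<close> is given in an affine chart by a vector \<open>w t\<close> with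
  \<open>w t \<bullet> b = 1\<close>. If \<open>L\<close> maps \<open>\<real>\<^sup>n\<close> isometrically onto the hyperplane orthogonal to \<open>b\<close>, then
  \<open>y \<mapsto> L y - (L y \<bullet> w t) b\<close> parametrizes the hyperplane orthogonal to \<open>\<gamma>\<^sub>2 t\<close>, and the foliation is
  \<open>\<Phi> (t, y) = \<gamma>\<^sub>1 t + L y - (L y \<bullet> w t) b\<close>. Transversality (iii) makes \<open>\<Phi>'\<close> invertible at the origin,
  so \<open>\<Phi>\<close> is a local diffeomorphism. Its leaves are affine and lie in the hyperplanes of (ii), so
  \<open>F \<circ> \<Phi>\<close> is Lipschitz along them; \<open>\<Phi>' (t, y)\<close> is affine in \<open>y\<close>, and
  \<open>A\<^sup>-\<^sup>1 - B\<^sup>-\<^sup>1 = A\<^sup>-\<^sup>1 (B - A) B\<^sup>-\<^sup>1\<close> transfers its Lipschitz bound to the inverse.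
\<close>

subsection \<open>Inverses of bounded linear maps\<close>

text \<open>A left inverse \<open>B\<close> of \<open>A\<close> and a right inverse
  \<open>B'\<close> of \<open>A'\<close> satisfy
  \<open>B - B' = - (B o\<^sub>L (A - A') o\<^sub>L B')\<close>; submultiplicativity of the operator
  norm does the rest.\<close>

lemma blinfun_inverse_diff_bound:
  fixes A A' :: "'a::real_normed_vector \<Rightarrow>\<^sub>L 'b::real_normed_vector" and B B' :: "'b \<Rightarrow>\<^sub>L 'a"
  assumes "B o\<^sub>L A = id_blinfun" and "A' o\<^sub>L B' = id_blinfun"
  shows "norm (B - B') \<le> norm B * norm (A - A') * norm B'"
proof -
  have 1: "blinfun_apply B (blinfun_apply A u) = u" for u
    using arg_cong[OF assms(1), of "\<lambda>f. blinfun_apply f u"] by simp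
  have 2: "blinfun_apply A' (blinfun_apply B' u) = u" for u
    using arg_cong[OF assms(2), of "\<lambda>f. blinfun_apply f u"] by simp
  have "B - B' = - (B o\<^sub>L (A - A') o\<^sub>L B')"
    by (rule blinfun_eqI) (simp add: blinfun.diff_left blinfun.diff_right blinfun.minus_left 1 2)
  then have "norm (B - B') = norm (B o\<^sub>L (A - A') o\<^sub>L B')"
    by simp
  also have "\<dots> \<le> norm (B o\<^sub>L (A - A')) * norm B'"
    by (rule norm_blinfun_compose)
  also have "\<dots> \<le> norm B * norm (A - A') * norm B'"
    by (intro mult_right_mono norm_blinfun_compose) simp
  finally show ?thesis .
qed

text \<open>The inverses are not assumed bounded near \<open>x0\<close>. Where
  \<open>norm (A x - A x0) * norm (B x0) < 1/2\<close>, the previous bound gives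
  \<open>norm (B x - B x0) \<le> norm (B x) / 2\<close>, hence
  \<open>norm (B x) \<le> 2 * norm (B x0)\<close>; inserted into the same bound, this forces
  \<open>B x\<close> to tend to \<open>B x0\<close>.\<close>

lemma continuous_on_blinfun_inverse:
  fixes A :: "'c::topological_space \<Rightarrow> 'a::real_normed_vector \<Rightarrow>\<^sub>L 'b::real_normed_vector"
  assumes cont: "continuous_on S A"
    and BA: "\<And>x. x \<in> S \<Longrightarrow> B x o\<^sub>L A x = id_blinfun"
    and AB: "\<And>x. x \<in> S \<Longrightarrow> A x o\<^sub>L B x = id_blinfun"
  shows "continuous_on S B"
  unfolding continuous_on_def
proof
  fix x0 assume x0: "x0 \<in> S"
  let ?K = "norm (B x0)" and ?F = "at x0 within S"
  have "((\<lambda>x. norm (A x - A x0)) \<longlongrightarrow> 0) ?F"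
    using cont x0 by (simp add: continuous_on_def tendsto_norm_zero_iff LIM_zero_iff)
  then have lim: "((\<lambda>x. norm (A x - A x0) * ?K) \<longlongrightarrow> 0) ?F"
    by (rule tendsto_mult_left_zero)
  then have "eventually (\<lambda>x. norm (A x - A x0) * ?K < 1/2) ?F"
    by (rule order_tendstoD) simp
  moreover have "eventually (\<lambda>x. x \<in> S) ?F"
    by (simp add: eventually_at_filter)
  ultimately have "eventually (\<lambda>x. norm (B x - B x0) \<le> (2 * ?K) * (norm (A x - A x0) * ?K)) ?F"
  proof eventually_elim
    case (elim x)
    have 1: "norm (B x - B x0) \<le> norm (B x) * (norm (A x - A x0) * ?K)"
      using blinfun_inverse_diff_bound[OF BA[OF elim(2)] AB[OF x0]] by (simp add: mult.assoc)
    also have "\<dots> \<le> norm (B x) * (1/2)"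
      using elim(1) by (intro mult_left_mono) auto
    finally have "norm (B x) \<le> 2 * ?K"
      using norm_triangle_ineq2[of "B x" "B x0"] by simp
    then have "norm (B x) * (norm (A x - A x0) * ?K) \<le> (2 * ?K) * (norm (A x - A x0) * ?K)"
      by (intro mult_right_mono) auto
    with 1 show ?case by linarith
  qed
  moreover have "((\<lambda>x. (2 * ?K) * (norm (A x - A x0) * ?K)) \<longlongrightarrow> 0) ?F"
    using tendsto_mult_right_zero[OF lim] .
  ultimately have "((\<lambda>x. B x - B x0) \<longlongrightarrow> 0) ?F"
    by (rule Lim_null_comparison)
  then show "(B \<longlongrightarrow> B x0) ?F"
    by (simp add: LIM_zero_iff)
qed

lemma blinfun_inv_eqI:
  fixes A :: "'a::euclidean_space \<Rightarrow>\<^sub>L 'b::euclidean_space"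
  assumes "B o\<^sub>L A = id_blinfun" and "A o\<^sub>L B = id_blinfun"
  shows "blinfun_inv A = B"
proof -
  have "inv (blinfun_apply A) = blinfun_apply B"
  proof (rule inv_equality)
    show "blinfun_apply B (blinfun_apply A u) = u" for u
      using arg_cong[OF assms(1), of "\<lambda>f. blinfun_apply f u"] by simp
    show "blinfun_apply A (blinfun_apply B u) = u" for u
      using arg_cong[OF assms(2), of "\<lambda>f. blinfun_apply f u"] by simp
  qed
  then show ?thesis
    by (simp add: blinfun_inv_def blinfun_apply_inverse)
qed

subsection \<open>Diffeomorphisms of class \<open>C\<^sup>1\<close>\<close>

lemma total_deriv_eq:
  assumes "(f has_derivative blinfun_apply f') (at x)"
  shows "total_deriv f x = f'"
  by (simp add: total_deriv_def blinfun_apply_inverse flip: frechet_derivative_at[OF assms])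

lemma C1_on_subset: "C1_on f S \<Longrightarrow> T \<subseteq> S \<Longrightarrow> C1_on f T"
  unfolding C1_on_def by (meson continuous_on_subset subsetD)

lemma C1_on_imp_continuous_on: "C1_on f S \<Longrightarrow> continuous_on S f"
  unfolding C1_on_def by (meson continuous_at_imp_continuous_on has_derivative_continuous)

lemma C1_on_cong:
  assumes "C1_on f S" and "open S" and "\<And>x. x \<in> S \<Longrightarrow> f x = g x"
  shows "C1_on g S"
  using assms unfolding C1_on_def by (meson has_derivative_transform_within_open)

text \<open>The image of \<open>A'\<close> is open because it is the preimage of \<open>A'\<close>
  under the continuous inverse, and on it the inverses \<open>inv_into A f\<close> and
  \<open>inv_into A' f\<close> agree.\<close>

lemma C1_diffeo_subset:
  assumes "C1_diffeo f A B" and "A' \<subseteq> A" and "open A'"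
  shows "C1_diffeo f A' (f ` A')"
proof -
  let ?g = "inv_into A f"
  have A: "open A" and B: "open B" and bij: "bij_betw f A B" and f: "C1_on f A" and g: "C1_on ?g B"
    using assms(1) by (auto simp: C1_diffeo_def)
  have inj: "inj_on f A" and fA: "f ` A = B"
    using bij by (auto simp: bij_betw_def)
  have "f ` A' = B \<inter> ?g -` A'"
    using assms(2) inj fA by (force simp: f_inv_into_f image_iff)
  then have op: "open (f ` A')"
    using continuous_open_preimage[OF C1_on_imp_continuous_on[OF g] B assms(3)] by simp
  have inj': "inj_on f A'"
    using inj assms(2) by (rule inj_on_subset)
  have "C1_on ?g (f ` A')"
    using g by (rule C1_on_subset) (use assms(2) fA in auto)
  then have "C1_on (inv_into A' f) (f ` A')"
    using op
  proof (rule C1_on_cong)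
    show "?g z = inv_into A' f z" if "z \<in> f ` A'" for z
      using that inj inj' assms(2) by (auto simp: subset_iff)
  qed
  then show ?thesis
    using assms(3) op inj' C1_on_subset[OF f assms(2)]
    by (simp add: C1_diffeo_def inj_on_imp_bij_betw)
qed

text \<open>With \<open>g\<close> the inverse of \<open>f\<close>, the witness is
  \<open>g' (f x)\<close>. Differentiating both \<open>g \<circ> f\<close> and
  \<open>f \<circ> g\<close>, which are locally the identity, shows by uniqueness of derivatives
  that it is a two-sided inverse.\<close>

lemma C1_diffeo_inverse_derivative:
  assumes diffeo: "C1_diffeo f A B"
    and der: "\<And>x. x \<in> A \<Longrightarrow> (f has_derivative blinfun_apply (f' x)) (at x)"
  obtains G where "continuous_on A G"
    and "\<And>x. x \<in> A \<Longrightarrow> G x o\<^sub>L f' x = id_blinfun"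
    and "\<And>x. x \<in> A \<Longrightarrow> f' x o\<^sub>L G x = id_blinfun"
proof -
  let ?g = "inv_into A f"
  have A: "open A" and B: "open B" and bij: "bij_betw f A B" and f: "C1_on f A" and g: "C1_on ?g B"
    using diffeo by (auto simp: C1_diffeo_def)
  have inj: "inj_on f A" and fA: "f ` A = B"
    using bij by (auto simp: bij_betw_def)
  obtain g' where g': "\<And>z. z \<in> B \<Longrightarrow> (?g has_derivative blinfun_apply (g' z)) (at z)"
    and cg': "continuous_on B g'"
    using g by (auto simp: C1_on_def)
  show ?thesis
  proof
    show "continuous_on A (\<lambda>x. g' (f x))"
      using continuous_on_compose2[OF cg' C1_on_imp_continuous_on[OF f]] fA by auto
  next
    fix x assume x: "x \<in> A"
    then have fx: "f x \<in> B" and gfx: "?g (f x) = x"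
      using fA inj by auto
    have "((?g \<circ> f) has_derivative blinfun_apply (g' (f x)) \<circ> blinfun_apply (f' x)) (at x)"
      using der[OF x] g'[OF fx] by (rule diff_chain_at)
    then have "((\<lambda>u. u) has_derivative blinfun_apply (g' (f x)) \<circ> blinfun_apply (f' x)) (at x)"
      by (rule has_derivative_transform_within_open[OF _ A x]) (use inj in simp)
    then have "blinfun_apply (g' (f x)) \<circ> blinfun_apply (f' x) = (\<lambda>u. u)"
      using has_derivative_ident by (rule has_derivative_unique)
    then show "g' (f x) o\<^sub>L f' x = id_blinfun"
      by (auto intro!: blinfun_eqI simp: fun_eq_iff)
    have "((f \<circ> ?g) has_derivative blinfun_apply (f' x) \<circ> blinfun_apply (g' (f x))) (at (f x))"
      using g'[OF fx] der[OF x] by (intro diff_chain_at) (simp_all add: gfx)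
    then have "((\<lambda>u. u) has_derivative blinfun_apply (f' x) \<circ> blinfun_apply (g' (f x))) (at (f x))"
      by (rule has_derivative_transform_within_open[OF _ B fx]) (use fA in \<open>simp add: f_inv_into_f\<close>)
    then have "blinfun_apply (f' x) \<circ> blinfun_apply (g' (f x)) = (\<lambda>u. u)"
      using has_derivative_ident by (rule has_derivative_unique)
    then show "f' x o\<^sub>L g' (f x) = id_blinfun"
      by (auto intro!: blinfun_eqI simp: fun_eq_iff)
  qed
qed

text \<open>A trivial kernel supplies the left inverse for the inverse function theorem. That
  theorem gives a local inverse differentiable at each point; continuity of its derivative then
  follows from continuity of inversion.\<close>

lemma C1_local_diffeo:
  fixes f :: "'a::euclidean_space \<Rightarrow> 'a" and f' :: "'a \<Rightarrow> 'a \<Rightarrow>\<^sub>L 'a"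
  assumes "open U" and "x0 \<in> U"
    and der: "\<And>x. x \<in> U \<Longrightarrow> (f has_derivative blinfun_apply (f' x)) (at x)"
    and cont: "continuous_on U f'"
    and ker: "\<And>u. blinfun_apply (f' x0) u = 0 \<Longrightarrow> u = 0"
  obtains A where "A \<subseteq> U" and "x0 \<in> A" and "C1_diffeo f A (f ` A)"
proof -
  have lin: "linear (blinfun_apply (f' x0))"
    by (simp add: blinfun.bounded_linear_right bounded_linear.linear)
  then have "inj (blinfun_apply (f' x0))"
    using ker linear_injective_0 by blast
  then obtain h where h: "linear h" "h \<circ> blinfun_apply (f' x0) = id"
    using linear_injective_left_inverse[OF lin] by blast
  have "Blinfun h o\<^sub>L f' x0 = id_blinfun"
    using h by (auto intro!: blinfun_eqI
        simp: bounded_linear_Blinfun_apply linear_conv_bounded_linear fun_eq_iff)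
  then obtain A V g g' where A: "open A" "A \<subseteq> U" "x0 \<in> A" and V: "open V"
    and hom: "homeomorphism A V f g"
    and g': "\<And>y. y \<in> V \<Longrightarrow> (g has_derivative (g' y)) (at y)"
      "\<And>y. y \<in> V \<Longrightarrow> g' y = inv (blinfun_apply (f'(g y)))"
      "\<And>y. y \<in> V \<Longrightarrow> bij (blinfun_apply (f'(g y)))"
    using inverse_function_theorem[OF assms(1) der cont assms(2)] by metis
  have fA: "f ` A = V" and gf: "\<And>x. x \<in> A \<Longrightarrow> g (f x) = x" and fg: "\<And>y. y \<in> V \<Longrightarrow> f (g y) = y"
    and gV: "g ` V = A" and cg: "continuous_on V g"
    using hom by (auto simp: homeomorphism_def)
  have inj: "inj_on f A"
    using gf by (rule inj_on_inverseI)
  have bl: "bounded_linear (g' y)" if "y \<in> V" for y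
    using g'(1)[OF that] by (rule has_derivative_bounded_linear)
  define G where "G y = Blinfun (g' y)" for y
  have G: "blinfun_apply (G y) = g' y" if "y \<in> V" for y
    using bl[OF that] by (simp add: G_def bounded_linear_Blinfun_apply)
  have "continuous_on V G"
  proof (rule continuous_on_blinfun_inverse)
    show "continuous_on V (\<lambda>y. f' (g y))"
      using cont cg by (rule continuous_on_compose2) (use gV A in auto)
    show "G y o\<^sub>L f' (g y) = id_blinfun" if "y \<in> V" for y
      using g'(2,3)[OF that] G[OF that]
      by (auto intro!: blinfun_eqI simp: bij_is_inj)
    show "f' (g y) o\<^sub>L G y = id_blinfun" if "y \<in> V" for y
      using g'(2,3)[OF that] G[OF that]
      by (auto intro!: blinfun_eqI simp: bij_is_surj surj_f_inv_f)
  qed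
  then have "C1_on g V"
    using g'(1) G unfolding C1_on_def by (intro exI[of _ G]) simp
  then have "C1_on (inv_into A f) V"
    using V
  proof (rule C1_on_cong)
    show "g y = inv_into A f y" if "y \<in> V" for y
      using inv_into_f_f[OF inj, of "g y"] that gV fg by auto
  qed
  moreover have "C1_on f A"
    using der cont A(2) unfolding C1_on_def by (meson continuous_on_subset subsetD)
  ultimately have "C1_diffeo f A (f ` A)"
    using A V fA inj by (simp add: C1_diffeo_def bij_betw_def)
  with A show ?thesis using that by blast
qed

lemma lipschitz_fixing_first_subset:
  "lipschitz_fixing_first D g \<Longrightarrow> D' \<subseteq> D \<Longrightarrow> lipschitz_fixing_first D' g"
  unfolding lipschitz_fixing_first_def by (meson subsetD)

text \<open>Continuity keeps the inverse derivative below a constant \<open>C\<close> in norm on a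
  neighborhood \<open>N\<close> of \<open>z\<close>. There the bound for differences of inverses
  turns a Lipschitz constant \<open>L\<close> of the derivative into
  \<open>C * L * C\<close>.\<close>

lemma lipschitz_fixing_first_inverse_derivative:
  fixes \<Phi> :: "real \<times> (real^'n) \<Rightarrow> real \<times> (real^'n)"
  assumes diffeo: "C1_diffeo \<Phi> D B" and "z \<in> D"
    and der: "\<And>x. x \<in> D \<Longrightarrow> (\<Phi> has_derivative blinfun_apply (\<Phi>' x)) (at x)"
    and lip: "lipschitz_fixing_first D \<Phi>'"
  obtains N where "open N" and "z \<in> N" and "N \<subseteq> D"
    and "lipschitz_fixing_first N (\<lambda>x. blinfun_inv (total_deriv \<Phi> x))"
proof -
  obtain G where G: "continuous_on D G"
    and GP: "\<And>x. x \<in> D \<Longrightarrow> G x o\<^sub>L \<Phi>' x = id_blinfun"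
    and PG: "\<And>x. x \<in> D \<Longrightarrow> \<Phi>' x o\<^sub>L G x = id_blinfun"
    using C1_diffeo_inverse_derivative[OF diffeo der] by metis
  have eq: "blinfun_inv (total_deriv \<Phi> x) = G x" if "x \<in> D" for x
    using total_deriv_eq[OF der[OF that]] blinfun_inv_eqI[OF GP[OF that] PG[OF that]] by simp
  obtain L where L: "L > 0" "\<And>s x y. (s, x) \<in> D \<Longrightarrow> (s, y) \<in> D \<Longrightarrow>
      norm (\<Phi>' (s, x) - \<Phi>' (s, y)) \<le> L * norm (x - y)"
    using lip unfolding lipschitz_fixing_first_def by blast
  define C where "C = norm (G z) + 1"
  define N where "N = D \<inter> (\<lambda>x. norm (G x)) -` {..<C}"
  have C: "C > 0"
    unfolding C_def by (simp add: add_nonneg_pos)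
  have "open D"
    using diffeo by (simp add: C1_diffeo_def)
  then have "open N"
    unfolding N_def by (intro continuous_open_preimage continuous_on_norm G) auto
  moreover have "z \<in> N" "N \<subseteq> D"
    using \<open>z \<in> D\<close> by (auto simp: N_def C_def)
  moreover have "lipschitz_fixing_first N (\<lambda>x. blinfun_inv (total_deriv \<Phi> x))"
    unfolding lipschitz_fixing_first_def
  proof (intro exI[of _ "C * L * C"] conjI allI impI)
    show "C * L * C > 0" using C L by simp
    fix s x y assume N: "(s, x) \<in> N" "(s, y) \<in> N"
    then have D: "(s, x) \<in> D" "(s, y) \<in> D" and n: "norm (G (s, x)) \<le> C" "norm (G (s, y)) \<le> C"
      by (auto simp: N_def)
    have "norm (G (s, x) - G (s, y))
        \<le> norm (G (s, x)) * norm (\<Phi>' (s, x) - \<Phi>' (s, y)) * norm (G (s, y))"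
      using GP[OF D(1)] PG[OF D(2)] by (rule blinfun_inverse_diff_bound)
    also have "\<dots> \<le> C * (L * norm (x - y)) * C"
      using n L(2)[OF D] C L(1) by (intro mult_mono) auto
    finally show "norm (blinfun_inv (total_deriv \<Phi> (s, x)) - blinfun_inv (total_deriv \<Phi> (s, y)))
        \<le> C * L * C * norm (x - y)"
      using D by (simp add: eq mult_ac)
  qed
  ultimately show ?thesis using that by blast
qed

subsection \<open>Affine charts of projective space and the modulus of continuity\<close>

text \<open>Rescaling a vector of \<open>l\<close> with nonzero \<open>b\<close>-coordinate gives
  \<open>u\<close> with \<open>u \<bullet> b = 1\<close>. Since \<open>l\<close> has dimension one,
  \<open>u\<close> spans it, so \<open>u\<close> is the chart value and orthogonality to
  \<open>l\<close> can be tested on \<open>u\<close> alone.\<close>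

lemma proj_chart_properties:
  assumes "l \<in> proj_chart_dom b"
  shows "proj_chart b l \<bullet> b = 1"
    and "perp x l \<longleftrightarrow> x \<bullet> proj_chart b l = 0"
proof -
  obtain v where l: "subspace l" "dim l = 1" and v: "v \<in> l" "v \<bullet> b \<noteq> 0"
    using assms by (auto simp: proj_chart_dom_def proj_space_def)
  define u where "u = (1 / (v \<bullet> b)) *\<^sub>R v"
  have u: "u \<in> l" "u \<bullet> b = 1"
    using l v by (auto simp: u_def subspace_scale)
  then have "u \<noteq> 0" by auto
  have "span {u} = l"
    using \<open>u \<noteq> 0\<close> u l by (intro subspace_dim_equal span_minimal) auto
  then have lin: "\<exists>k. x = k *\<^sub>R u" if "x \<in> l" for x
    using that by (auto simp: span_singleton)
  have "proj_chart b l = u"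
    unfolding proj_chart_def
  proof (rule the_equality)
    show "x = u" if "x \<in> l \<and> x \<bullet> b = 1" for x
      using lin[of x] that u by auto
  qed (use u in simp)
  then show "proj_chart b l \<bullet> b = 1" "perp x l \<longleftrightarrow> x \<bullet> proj_chart b l = 0"
    using u lin by (auto simp: perp_def orthogonal_def) (metis inner_scaleR_right mult_zero_right)
qed

text \<open>Each admissible pair of distinct points contributes its quotient to the supremum; the
  case \<open>x = y\<close>, absent from the supremum, is trivial.\<close>

lemma modulus_cont_less_imp_norm_diff_le:
  assumes "modulus_cont U F p v \<delta> < ennreal M" and "M > 0"
    and "x \<in> U \<inter> ball p \<delta>" and "y \<in> U \<inter> ball p \<delta>" and "perp (x - p) v" and "perp (y - p) v"
  shows "norm (F x - F y) \<le> M * norm (x - y)"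
proof (cases "x = y")
  case False
  have "ennreal (norm (F x - F y) / norm (x - y)) \<le> modulus_cont U F p v \<delta>"
    unfolding modulus_cont_def using assms(3-6) False by (intro Sup_upper) blast
  then have "ennreal (norm (F x - F y) / norm (x - y)) < ennreal M"
    using assms(1) by (rule le_less_trans)
  then have "norm (F x - F y) / norm (x - y) < M"
    using assms(2) by (simp add: ennreal_less_iff)
  then show ?thesis
    using False by (simp add: divide_simps split: if_splits)
qed simp

subsection \<open>The foliation by affine hyperplanes\<close>

definition leaf_map ::
  "('b \<Rightarrow> 'a) \<Rightarrow> 'a \<Rightarrow> (real \<Rightarrow> 'a) \<Rightarrow> (real \<Rightarrow> 'a) \<Rightarrow> real \<times> 'b::euclidean_space \<Rightarrow> 'a::euclidean_space"
  where "leaf_map L b w \<gamma> = (\<lambda>(t, y). \<gamma> t + L y - (L y \<bullet> w t) *\<^sub>R b)"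

text \<open>The last term comes from the motion of the normal \<open>w t\<close> with
  \<open>t\<close>. It is the only one in which the base point \<open>y\<close> occurs.\<close>

definition leaf_map_deriv ::
  "('b \<Rightarrow> 'a) \<Rightarrow> 'a \<Rightarrow> (real \<Rightarrow> 'a) \<Rightarrow> (real \<Rightarrow> 'a) \<Rightarrow> (real \<Rightarrow> 'a) \<Rightarrow> real \<times> 'b::euclidean_space \<Rightarrow>
    (real \<times> 'b) \<Rightarrow>\<^sub>L 'a::euclidean_space"
  where "leaf_map_deriv L b w w' \<gamma>' = (\<lambda>(t, y). Blinfun (\<lambda>(h, k).
    h *\<^sub>R \<gamma>' t + L k - (L k \<bullet> w t) *\<^sub>R b - (h * (L y \<bullet> w' t)) *\<^sub>R b))"

context
  fixes L :: "'b::euclidean_space \<Rightarrow> 'a::euclidean_space" and b :: 'a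
  assumes L: "linear L"
begin

lemma leaf_map_deriv_apply:
  "blinfun_apply (leaf_map_deriv L b w w' \<gamma>' (t, y)) (h, k) =
    h *\<^sub>R \<gamma>' t + L k - (L k \<bullet> w t) *\<^sub>R b - (h * (L y \<bullet> w' t)) *\<^sub>R b"
proof -
  note [simp] = linear_add[OF L] linear_scale[OF L]
  have "linear (\<lambda>(h, k). h *\<^sub>R \<gamma>' t + L k - (L k \<bullet> w t) *\<^sub>R b - (h * (L y \<bullet> w' t)) *\<^sub>R b)"
    by (rule linearI) (auto simp: algebra_simps inner_simps)
  then show ?thesis
    by (simp add: leaf_map_deriv_def bounded_linear_Blinfun_apply linear_conv_bounded_linear)
qed

lemma leaf_map_has_derivative:
  assumes "(\<gamma> has_vector_derivative \<gamma>' t) (at t)" and "(w has_vector_derivative w' t) (at t)"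
  shows "(leaf_map L b w \<gamma> has_derivative blinfun_apply (leaf_map_deriv L b w w' \<gamma>' (t, y))) (at (t, y))"
proof -
  have fst: "(fst has_derivative fst) (at (t, y))" and snd: "(snd has_derivative snd) (at (t, y))"
    by (auto intro!: derivative_eq_intros)
  have \<gamma>: "((\<lambda>x. \<gamma> (fst x)) has_derivative (\<lambda>u. fst u *\<^sub>R \<gamma>' t)) (at (t, y))"
    using has_derivative_compose[OF fst, of \<gamma> "\<lambda>h. h *\<^sub>R \<gamma>' t"] assms(1)
    by (simp add: has_vector_derivative_def)
  have w: "((\<lambda>x. w (fst x)) has_derivative (\<lambda>u. fst u *\<^sub>R w' t)) (at (t, y))"
    using has_derivative_compose[OF fst, of w "\<lambda>h. h *\<^sub>R w' t"] assms(2)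
    by (simp add: has_vector_derivative_def)
  have L': "((\<lambda>x. L (snd x)) has_derivative (\<lambda>u. L (snd u))) (at (t, y))"
    using has_derivative_compose[OF snd linear_imp_has_derivative[OF L]] by simp
  have eq: "leaf_map L b w \<gamma> = (\<lambda>x. \<gamma> (fst x) + L (snd x) - (L (snd x) \<bullet> w (fst x)) *\<^sub>R b)"
    by (auto simp: leaf_map_def)
  show ?thesis
    unfolding eq
    by (rule has_derivative_eq_rhs, (rule derivative_intros \<gamma> w L')+)
       (auto simp: leaf_map_deriv_apply algebra_simps)
qed

text \<open>In finite dimension, continuity for the operator norm follows from continuity of the
  values at each fixed vector.\<close>

lemma continuous_on_leaf_map_deriv:
  assumes "continuous_on T \<gamma>'" and "continuous_on T w" and "continuous_on T w'"
  shows "continuous_on (T \<times> UNIV) (leaf_map_deriv L b w w' \<gamma>')"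
proof (rule continuous_on_blinfun_componentwise)
  fix i :: "real \<times> 'b"
  have fst: "continuous_on (T \<times> UNIV) (\<lambda>x. g (fst x))" if "continuous_on T g"
    for g :: "real \<Rightarrow> 'a"
    by (rule continuous_on_compose2[OF that continuous_on_fst[OF continuous_on_id]]) auto
  have L': "continuous_on (T \<times> UNIV) (\<lambda>x. L (snd x))"
    by (rule continuous_on_compose2[OF linear_continuous_on[OF L[unfolded linear_conv_bounded_linear]]
          continuous_on_snd[OF continuous_on_id]]) auto
  have eq: "(\<lambda>x. blinfun_apply (leaf_map_deriv L b w w' \<gamma>' x) i) =
    (\<lambda>x. fst i *\<^sub>R \<gamma>' (fst x) + L (snd i) - (L (snd i) \<bullet> w (fst x)) *\<^sub>R b
      - (fst i * (L (snd x) \<bullet> w' (fst x))) *\<^sub>R b)"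
    using leaf_map_deriv_apply[of _ _ _ _ _ "fst i" "snd i"] by (auto simp: fun_eq_iff)
  show "continuous_on (T \<times> UNIV) (\<lambda>x. blinfun_apply (leaf_map_deriv L b w w' \<gamma>' x) i)"
    unfolding eq using assms by (auto intro!: continuous_intros fst L')
qed

text \<open>Only the term with \<open>w' t\<close> survives in the difference, leaving a multiple of
  the unit vector \<open>b\<close> that Cauchy-Schwarz bounds.\<close>

lemma norm_leaf_map_deriv_diff:
  assumes "\<And>y. norm (L y) = norm y" and "norm b = 1"
  shows "norm (leaf_map_deriv L b w w' \<gamma>' (t, x) - leaf_map_deriv L b w w' \<gamma>' (t, y))
    \<le> norm (w' t) * norm (x - y)"
proof (rule norm_blinfun_bound)
  fix u :: "real \<times> 'b"
  obtain h k where u: "u = (h, k)" by force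
  have h: "\<bar>h\<bar> \<le> norm u"
    using norm_fst_le[of h k] u by simp
  have "L y - L x = L (y - x)"
    by (simp add: linear_diff[OF L])
  then have "blinfun_apply (leaf_map_deriv L b w w' \<gamma>' (t, x) - leaf_map_deriv L b w w' \<gamma>' (t, y)) u
      = (h * (L (y - x) \<bullet> w' t)) *\<^sub>R b"
    by (simp add: u blinfun.diff_left leaf_map_deriv_apply algebra_simps inner_simps
        flip: \<open>L y - L x = L (y - x)\<close>)
  then have "norm (blinfun_apply (leaf_map_deriv L b w w' \<gamma>' (t, x) - leaf_map_deriv L b w w' \<gamma>' (t, y)) u)
      = \<bar>h\<bar> * \<bar>L (y - x) \<bullet> w' t\<bar>"
    using assms(2) by (simp add: abs_mult)
  also have "\<dots> \<le> norm u * (norm (y - x) * norm (w' t))"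
    using h Cauchy_Schwarz_ineq2[of "L (y - x)" "w' t"] assms(1) by (intro mult_mono) auto
  finally show "norm (blinfun_apply (leaf_map_deriv L b w w' \<gamma>' (t, x) - leaf_map_deriv L b w w' \<gamma>' (t, y)) u)
      \<le> norm (w' t) * norm (x - y) * norm u"
    by (simp add: mult_ac norm_minus_commute)
qed simp

lemma norm_leaf_map_diff:
  assumes "\<And>y. norm (L y) = norm y" and "norm b = 1"
  shows "norm (leaf_map L b w \<gamma> (t, x) - leaf_map L b w \<gamma> (t, y)) \<le> (1 + norm (w t)) * norm (x - y)"
proof -
  have "leaf_map L b w \<gamma> (t, x) - leaf_map L b w \<gamma> (t, y) = L (x - y) - (L (x - y) \<bullet> w t) *\<^sub>R b"
    by (simp add: leaf_map_def linear_diff[OF L] algebra_simps inner_simps)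
  also have "norm \<dots> \<le> norm (L (x - y)) + \<bar>L (x - y) \<bullet> w t\<bar>"
    using norm_triangle_ineq4[of "L (x - y)" "(L (x - y) \<bullet> w t) *\<^sub>R b"] assms(2) by simp
  also have "\<dots> \<le> norm (x - y) + norm (x - y) * norm (w t)"
    using Cauchy_Schwarz_ineq2[of "L (x - y)" "w t"] assms(1) by simp
  finally show ?thesis by (simp add: algebra_simps)
qed

text \<open>At \<open>y = 0\<close> the term with \<open>w' t\<close> vanishes, and the two
  remaining kinds of direction are separated by scalar products with \<open>w t\<close> and with
  \<open>b\<close>.\<close>

lemma leaf_map_deriv_zero_kernel:
  assumes norm: "\<And>y. norm (L y) = norm y" and Lb: "\<And>y. L y \<bullet> b = 0"
    and "norm b = 1" and wb: "w t \<bullet> b = 1" and trans: "\<gamma>' t \<bullet> w t \<noteq> 0"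
    and zero: "blinfun_apply (leaf_map_deriv L b w w' \<gamma>' (t, 0)) u = 0"
  shows "u = 0"
proof -
  obtain h k where u: "u = (h, k)" by force
  have eq: "h *\<^sub>R \<gamma>' t + L k - (L k \<bullet> w t) *\<^sub>R b = 0"
    using zero by (simp add: u leaf_map_deriv_apply linear_0[OF L])
  \<comment> \<open>In the product with \<open>w t\<close> the two terms in \<open>L k\<close>
    cancel because \<open>w t \<bullet> b = 1\<close>.\<close>
  have "h * (\<gamma>' t \<bullet> w t) = 0"
    using arg_cong[OF eq, of "\<lambda>v. v \<bullet> w t"] wb by (simp add: inner_simps inner_commute)
  then have h: "h = 0" using trans by simp
  have "b \<bullet> b = 1" using \<open>norm b = 1\<close> by (simp add: dot_square_norm)
  then have "L k \<bullet> w t = 0"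
    using arg_cong[OF eq, of "\<lambda>v. v \<bullet> b"] h Lb by (simp add: inner_simps)
  then have "L k = 0" using eq h by simp
  then have "k = 0" using norm[of k] by simp
  with h u show ?thesis by (simp add: zero_prod_def)
qed

end

theorem theorem4p3:
  fixes U :: "(real \<times> (real^'n)) set"
    and p\<^sub>0 :: "real \<times> (real^'n)"
    and F :: "real \<times> (real^'n) \<Rightarrow> real \<times> (real^'n)"
    and J :: "real set"
    and \<gamma>\<^sub>1 :: "real \<Rightarrow> real \<times> (real^'n)"
    and \<gamma>\<^sub>2 :: "real \<Rightarrow> (real \<times> (real^'n)) set"
  assumes "open U" and "p\<^sub>0 \<in> U" and "continuous_on U F"
    and "open J" and "is_interval J" and "0 \<in> J"
    and "\<gamma>\<^sub>1 ` J \<subseteq> U" and "\<gamma>\<^sub>1 C1_differentiable_on J"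
    and "C1_proj_path_on J \<gamma>\<^sub>2"
    and "inj_on (\<lambda>t. (\<gamma>\<^sub>1 t, \<gamma>\<^sub>2 t)) J"
    and "\<gamma>\<^sub>1 0 = p\<^sub>0"
    and "\<exists>\<delta>>0. \<exists>M>0. \<forall>t\<in>J. modulus_cont U F (\<gamma>\<^sub>1 t) (\<gamma>\<^sub>2 t) \<delta> < ennreal M"
    and "\<not> perp (vector_derivative \<gamma>\<^sub>1 (at 0)) (\<gamma>\<^sub>2 0)"
  shows "\<exists>U' J' V' g. U' \<subseteq> U \<and> local_foliation g J' V' U' p\<^sub>0 \<and>
    (\<exists>N. open N \<and> (0, 0) \<in> N \<and> N \<subseteq> J' \<times> V' \<and>
       lipschitz_fixing_first N (F \<circ> foliation_map g) \<and>
       lipschitz_fixing_first N (\<lambda>x. blinfun_inv (total_deriv (foliation_map g) x)))"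
proof -
  let ?E = "UNIV :: (real^'n) set"

  \<comment> \<open>Local data near the origin\<close>
  obtain \<delta> M where \<delta>: "\<delta> > 0" and M: "M > 0"
    and mod: "\<And>t. t \<in> J \<Longrightarrow> modulus_cont U F (\<gamma>\<^sub>1 t) (\<gamma>\<^sub>2 t) \<delta> < ennreal M"
    using assms(12) by blast
  obtain b T where b: "b \<in> Basis" and T: "open T" "0 \<in> T" "T \<subseteq> J"
    and dom: "\<gamma>\<^sub>2 ` T \<subseteq> proj_chart_dom b" and C1: "(proj_chart b \<circ> \<gamma>\<^sub>2) C1_differentiable_on T"
    using assms(9) \<open>0 \<in> J\<close> unfolding C1_proj_path_on_def by blast
  define w where "w = proj_chart b \<circ> \<gamma>\<^sub>2"
  have nb: "norm b = 1" using b by simp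
  have wb: "w t \<bullet> b = 1" and perp: "perp x (\<gamma>\<^sub>2 t) \<longleftrightarrow> x \<bullet> w t = 0" if "t \<in> T" for t x
    using proj_chart_properties(1)[of "\<gamma>\<^sub>2 t" b] proj_chart_properties(2)[of "\<gamma>\<^sub>2 t" b x] dom that
    by (auto simp: w_def)
  obtain w' where w': "\<And>t. t \<in> T \<Longrightarrow> (w has_vector_derivative w' t) (at t)"
    and cw': "continuous_on T w'"
    using C1 unfolding C1_differentiable_on_def w_def by blast
  obtain \<gamma>' where \<gamma>': "\<And>t. t \<in> T \<Longrightarrow> (\<gamma>\<^sub>1 has_vector_derivative \<gamma>' t) (at t)"
    and c\<gamma>': "continuous_on T \<gamma>'"
    using C1_differentiable_on_subset[OF assms(8) T(3)] unfolding C1_differentiable_on_def by blast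
  have cw: "continuous_on T w" and c\<gamma>: "continuous_on T \<gamma>\<^sub>1"
    using w' \<gamma>' by (auto intro!: continuous_at_imp_continuous_on dest: has_vector_derivative_continuous)
  \<comment> \<open>This is the transversality hypothesis (iii) read in the chart at the
    origin.\<close>
  have trans: "\<gamma>' 0 \<bullet> w 0 \<noteq> 0"
    using assms(13) perp[OF T(2)] vector_derivative_at[OF \<gamma>'[OF T(2)]] by simp

  \<comment> \<open>The hyperplane foliation as a local diffeomorphism\<close>
  have "dim ?E = dim {x. b \<bullet> x = 0}"
    using dim_special_hyperplane[OF b] by simp
  \<comment> \<open>The chart at the origin dictates \<open>b\<close>, which may be any basis
    vector; equality of dimensions provides an isometry onto its orthogonal hyperplane in every
    case.\<close>
  then obtain L where L: "linear L" and LE: "L ` ?E = {x. b \<bullet> x = 0}"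
    and nL: "\<And>y. norm (L y) = norm y"
    using isometries_subspaces[OF subspace_UNIV subspace_hyperplane, of b] by (metis UNIV_I)
  have Lb: "L y \<bullet> b = 0" for y
    using LE by (auto simp: inner_commute)
  define \<Phi> where "\<Phi> = leaf_map L b w \<gamma>\<^sub>1"
  define \<Phi>' where "\<Phi>' = leaf_map_deriv L b w w' \<gamma>'"
  have der: "(\<Phi> has_derivative blinfun_apply (\<Phi>' x)) (at x)" if "x \<in> T \<times> ?E" for x
    using that leaf_map_has_derivative[OF L, of \<gamma>\<^sub>1 \<gamma>' "fst x" w w' b "snd x"] \<gamma>' w'
    by (auto simp: \<Phi>_def \<Phi>'_def)
  have c\<Phi>': "continuous_on (T \<times> ?E) \<Phi>'"
    unfolding \<Phi>'_def using L c\<gamma>' cw cw' by (rule continuous_on_leaf_map_deriv)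
  have c\<Phi>: "continuous_on (T \<times> ?E) \<Phi>"
    using der by (meson continuous_at_imp_continuous_on has_derivative_continuous)
  have opT: "open (T \<times> ?E)" and 0: "(0, 0) \<in> T \<times> ?E"
    using T by (auto intro: open_Times)
  have ker: "u = 0" if "blinfun_apply (\<Phi>' (0, 0)) u = 0" for u
    using leaf_map_deriv_zero_kernel[where \<gamma>' = \<gamma>' and w = w and t = 0, OF L nL Lb nb wb[OF T(2)] trans]
      that by (simp add: \<Phi>'_def)
  obtain A where A: "A \<subseteq> T \<times> ?E" "(0, 0) \<in> A" and A_diffeo: "C1_diffeo \<Phi> A (\<Phi> ` A)"
    using C1_local_diffeo[OF opT 0 der c\<Phi>' ker] by metis

  \<comment> \<open>Position of the leaves and choice of the neighborhood\<close>
  have leaf: "\<Phi> (t, y) - \<gamma>\<^sub>1 t = L y - (L y \<bullet> w t) *\<^sub>R b" for t y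
    by (simp add: \<Phi>_def leaf_map_def)
  have leaf_perp: "perp (\<Phi> (t, y) - \<gamma>\<^sub>1 t) (\<gamma>\<^sub>2 t)" if "t \<in> T" for t y
    using wb[OF that] by (simp add: leaf perp[OF that] inner_simps inner_commute)
  have \<Phi>0: "\<Phi> (0, 0) = p\<^sub>0"
    using leaf[of 0 0] assms(11) by (simp add: linear_0[OF L])

  \<comment> \<open>The bounds on \<open>w\<close> and \<open>w'\<close> make the later Lipschitz
    constants independent of \<open>t\<close>. The last two conditions place \<open>\<Phi> x\<close>
    in the part of \<open>U\<close> within distance \<open>\<delta>\<close> of
    \<open>\<gamma>\<^sub>1 t\<close>, where the modulus of continuity applies.\<close>
  define W where "W = {x \<in> T \<times> ?E. norm (w (fst x)) < norm (w 0) + 1 \<and>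
    norm (w' (fst x)) < norm (w' 0) + 1 \<and> \<Phi> x \<in> U \<and> dist (\<gamma>\<^sub>1 (fst x)) (\<Phi> x) < \<delta>}"
  have cfst: "continuous_on (T \<times> ?E) (\<lambda>x. g (fst x))" if "continuous_on T g"
    for g :: "real \<Rightarrow> real \<times> (real^'n)"
    by (rule continuous_on_compose2[OF that continuous_on_fst[OF continuous_on_id]]) auto
  have W_eq: "W = ((T \<times> ?E) \<inter> (\<lambda>x. norm (w (fst x))) -` {..<norm (w 0) + 1})
      \<inter> ((T \<times> ?E) \<inter> (\<lambda>x. norm (w' (fst x))) -` {..<norm (w' 0) + 1})
      \<inter> ((T \<times> ?E) \<inter> \<Phi> -` U) \<inter> ((T \<times> ?E) \<inter> (\<lambda>x. dist (\<gamma>\<^sub>1 (fst x)) (\<Phi> x)) -` {..<\<delta>})"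
    by (auto simp: W_def)
  have "open W"
    unfolding W_eq
    by (intro open_Int continuous_open_preimage opT continuous_on_norm continuous_on_dist cfst
        cw cw' c\<gamma> c\<Phi> assms(1) open_lessThan)
  moreover have "(0, 0) \<in> W"
    using T \<delta> assms(2,11) \<Phi>0 by (simp add: W_def)
  moreover have "open A"
    using A_diffeo by (simp add: C1_diffeo_def)
  ultimately have "open (A \<inter> W)" "(0, 0) \<in> A \<inter> W"
    using A by auto
  then obtain J1 V1 where JV1: "open J1" "open V1" "(0, 0) \<in> J1 \<times> V1" "J1 \<times> V1 \<subseteq> A \<inter> W"
    by (rule open_prod_elim)
  \<comment> \<open>The first factor is shrunk to a ball about 0 because the parameter set of a
    foliation has to be an open interval.\<close>
  then obtain r where r: "r > 0" "ball 0 r \<subseteq> J1"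
    by (meson mem_Sigma_iff open_contains_ball)
  define J' where "J' = ball (0::real) r"
  define D where "D = J' \<times> V1"
  have D: "D \<subseteq> A" "D \<subseteq> W" "open D" "(0, 0) \<in> D"
    using JV1 r by (auto simp: D_def J'_def intro: open_Times)
  have D_diffeo: "C1_diffeo \<Phi> D (\<Phi> ` D)"
    using A_diffeo D by (intro C1_diffeo_subset)
  have DT: "D \<subseteq> T \<times> ?E" using D A by blast

  \<comment> \<open>Lipschitz estimates along the leaves\<close>
  have lipF: "lipschitz_fixing_first D (F \<circ> \<Phi>)"
    unfolding lipschitz_fixing_first_def
  \<comment> \<open>The factor \<open>M\<close> comes from the modulus of continuity. The other
    factor bounds the Lipschitz constant \<open>1 + norm (w s)\<close> of the leaf, since
    \<open>norm (w s) < norm (w 0) + 1\<close> on \<open>W\<close>.\<close>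
  proof (intro exI[of _ "M * (norm (w 0) + 2)"] conjI allI impI)
    show "M * (norm (w 0) + 2) > 0" using M by (simp add: add_nonneg_pos)
    fix s x y assume D': "(s, x) \<in> D" "(s, y) \<in> D"
    then have W: "(s, x) \<in> W" "(s, y) \<in> W" and s: "s \<in> T"
      using D DT by auto
    have "norm (F (\<Phi> (s, x)) - F (\<Phi> (s, y))) \<le> M * norm (\<Phi> (s, x) - \<Phi> (s, y))"
      using W s T(3) by (intro modulus_cont_less_imp_norm_diff_le[OF mod[of s] M] leaf_perp) (auto simp: W_def)
    also have "\<dots> \<le> M * ((1 + norm (w s)) * norm (x - y))"
      unfolding \<Phi>_def using M by (intro mult_left_mono norm_leaf_map_diff[OF L nL nb]) auto
    also have "\<dots> \<le> M * ((norm (w 0) + 2) * norm (x - y))"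
      using M W by (intro mult_left_mono mult_right_mono) (auto simp: W_def)
    finally show "norm ((F \<circ> \<Phi>) (s, x) - (F \<circ> \<Phi>) (s, y)) \<le> M * (norm (w 0) + 2) * norm (x - y)"
      by (simp add: mult_ac)
  qed
  have lip': "lipschitz_fixing_first D \<Phi>'"
    unfolding lipschitz_fixing_first_def
  proof (intro exI[of _ "norm (w' 0) + 1"] conjI allI impI)
    show "norm (w' 0) + 1 > 0" by (simp add: add_nonneg_pos)
    fix s x y assume D': "(s, x) \<in> D" "(s, y) \<in> D"
    then have "(s, x) \<in> W" using D by auto
    then have "norm (w' s) * norm (x - y) \<le> (norm (w' 0) + 1) * norm (x - y)"
      by (intro mult_right_mono) (auto simp: W_def)
    then show "norm (\<Phi>' (s, x) - \<Phi>' (s, y)) \<le> (norm (w' 0) + 1) * norm (x - y)"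
      using norm_leaf_map_deriv_diff[OF L nL nb, of w w' \<gamma>' s x y] by (simp add: \<Phi>'_def)
  qed
  \<comment> \<open>Bounding the inverse derivative may require a set smaller than \<open>D\<close>:
    the foliation is defined on all of \<open>D\<close>, while both Lipschitz claims are made on
    \<open>N\<close>.\<close>
  obtain N where N: "open N" "(0, 0) \<in> N" "N \<subseteq> D"
    and lipN: "lipschitz_fixing_first N (\<lambda>x. blinfun_inv (total_deriv \<Phi> x))"
    using lipschitz_fixing_first_inverse_derivative[OF D_diffeo D(4) der lip'] DT by blast

  \<comment> \<open>Assembling the local foliation\<close>
  define g where "g = (\<lambda>s y. \<Phi> (s, y))"
  have fol: "foliation_map g = \<Phi>"
    by (auto simp: foliation_map_def g_def)
  have "g s differentiable_on V1" if "s \<in> J'" for s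
    unfolding differentiable_on_def g_def
  proof
    fix y assume "y \<in> V1"
    then have "(s, y) \<in> T \<times> ?E" using that DT by (auto simp: D_def)
    then have "\<Phi> differentiable at (s, y)"
      using der by (auto simp: differentiable_def)
    then have "(\<Phi> \<circ> Pair s) differentiable at y"
      by (intro differentiable_chain_at) (auto intro!: derivative_intros)
    then show "(\<lambda>y. \<Phi> (s, y)) differentiable at y within V1"
      by (simp add: o_def differentiable_at_withinI)
  qed
  then have "local_foliation g J' V1 (\<Phi> ` D) p\<^sub>0"
    unfolding local_foliation_def fol
    using JV1 r D D_diffeo \<Phi>0
    by (auto simp: D_def J'_def g_def C1_diffeo_def is_interval_ball_real)
  moreover have "\<Phi> ` D \<subseteq> U"
    using D by (auto simp: W_def)
  ultimately show ?thesis
    using N lipN lipschitz_fixing_first_subset[OF lipF N(3)] unfolding D_def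
    by (intro exI[of _ "\<Phi> ` D"] exI[of _ J'] exI[of _ V1] exI[of _ g]) (auto simp: fol D_def)
qed

end
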